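(* Let $n\in\mathbb{N}$ and $0<t\leq 1$. Then $$ \begin{aligned} \sum_{k=1}^{\infty}\frac{H_{k-1}t^k}{k^2\binom{n+k}{k}}={}&\zeta(3)-Li_3(1-t)-\frac{1}{2}\log^2(1-t)\sum_{k=1}^{n}\frac{1}{k}\left(\frac{t-1}{t}\right)^k\\ &+(\zeta(2)-Li_2(t))\log(1-t)+\log(1-t)\sum_{k=1}^{n}\frac{H_k}{k}\left(\frac{t-1}{t}\right)^k\\ &-\sum_{p=0}^{n-1}\left\{\sum_{k=1}^{n-p}\left(\frac{H_{p+k}-H_k}{(p+k)k}+\frac{1}{k^2(p+k)}\right)\right\}\left(\frac{t-1}{t}\right)^p-\frac{1}{2}\log t\,\log^2(1-t), \end{aligned} $$ where for $t=1$ the right-hand side is understood as its limit as $t\to1^-$.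
   Context: $\mathbb{N}=\{1,2,3,\dots\}$. $H_m=\sum_{j=1}^m \frac1j$ is the $m$-th harmonic number, with $H_0=0$. $Li_m(x)=\sum_{k\ge1}x^k/k^m$ for $|x|\le1$, $m\ge2$, is the polylogarithm, and $\zeta(s)=\sum_{k\ge1}k^{-s}$ is the Riemann zeta function. $\log^m x$ means $(\log x)^m$. Infinite series are limits of partial sums. *)

theory Defs
  imports "HOL-Analysis.Analysis"
begin

text \<open>
  Only meaningful where the series converge: \<open>m \<ge> 2\<close> and \<open>\<bar>x\<bar> \<le> 1\<close> for the polylogarithm, real
  \<open>s > 1\<close> for the zeta function.  The summation index is shifted by one.
\<close>

definition polylog :: "nat \<Rightarrow> real \<Rightarrow> real" where
  "polylog m x = (\<Sum>k. x ^ Suc k / real (Suc k) ^ m)"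

definition zeta :: "real \<Rightarrow> real" where
  "zeta s = (\<Sum>k. real (Suc k) powr (- s))"

text \<open>
  The closed form, meant for \<open>0 < t < 1\<close>.  Its value at \<open>t = 1\<close> is an artefact of \<open>ln 0 = 0\<close>; use
  the limit from the left there.
\<close>

definition closed_form :: "nat \<Rightarrow> real \<Rightarrow> real" where
  "closed_form n t =
     zeta 3 - polylog 3 (1 - t)
     - 1 / 2 * (ln (1 - t))\<^sup>2 * (\<Sum>k=1..n. 1 / real k * ((t - 1) / t) ^ k)
     + (zeta 2 - polylog 2 t) * ln (1 - t)
     + ln (1 - t) * (\<Sum>k=1..n. harm k / real k * ((t - 1) / t) ^ k)
     - (\<Sum>p=0..<n.
          (\<Sum>k=1..n - p. (harm (p + k) - harm k) / (real (p + k) * real k)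
                       + 1 / ((real k)\<^sup>2 * real (p + k)))
          * ((t - 1) / t) ^ p)
     - 1 / 2 * ln t * (ln (1 - t))\<^sup>2"

end

theory Submission
  imports Defs "HOL-Real_Asymp.Real_Asymp"
begin

text \<open>
  The weights \<open>1 / (k * ((n + k) choose k))\<close> are the Beta values \<open>B(k, n + 1)\<close>.  Hence they satisfy
  the Pascal rule \<open>B(k, n + 2) = B(k, n + 1) - B(k + 1, n + 1)\<close>.  In a power series in \<open>t\<close>, replacing
  \<open>k\<close> by \<open>k + 1\<close> in the coefficients amounts to dividing by \<open>t\<close> (after removal of the first term).
  So raising \<open>n\<close> by one multiplies \<open>\<Sum>k. B(k, n + 1) * t ^ k\<close> by \<open>u = (t - 1) / t\<close> and adds the
  constant \<open>1 / (n + 1)\<close>; this is where the powers of \<open>(t - 1) / t\<close> in the closed form come from.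

  Write \<open>V n\<close>, \<open>T n\<close>, \<open>S n\<close> for the sums over \<open>k\<close> of \<open>B(k, n + 1) * t ^ k\<close>,
  of \<open>H(k - 1) * B(k, n + 1) * t ^ k\<close> and of \<open>H(k - 1) * B(k, n + 1) / k * t ^ k\<close>; the last
  one is the series of the theorem.  For \<open>0 < t < 1\<close> one finds
  \<open>V (n + 1) = u * V n + 1 / (n + 1)\<close>, \<open>T (n + 1) = u * T n + V (n + 1) / (n + 1)\<close> and
  \<open>S (n + 1) = S n - T (n + 1) / (n + 1)\<close>.  The finite sums in the closed form obey the same
  recurrences (\<open>beta_sum_Suc\<close>, \<open>harm_beta_sum_Suc\<close>, \<open>closed_form_Suc\<close>), so everything reduces to \<open>n = 0\<close>.

  There \<open>V 0 = - ln (1 - t)\<close>, and \<open>T 0 = (ln (1 - t))\<^sup>2 / 2\<close> is the Cauchy square of that series.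
  Only \<open>S 0\<close>, the sum of \<open>H(k - 1) * t ^ k / k\<^sup>2\<close>, needs calculus (\<open>sums_harm_over_square\<close>): its derivative is
  \<open>T 0 / t\<close>, and Euler's reflection formula for the dilogarithm shows that the closed form has
  the same derivative; both sides vanish as \<open>t\<close> tends to \<open>0\<close>.

  At \<open>t = 1\<close> the coefficients are absolutely summable, so the series is continuous on \<open>[0, 1]\<close> and
  its value is the limit of the closed form from the left.
\<close>

section \<open>Power series with absolutely summable coefficients\<close>

lemma constant_on_unit_interval:
  fixes f :: "real \<Rightarrow> real"
  assumes "\<And>x. 0 < x \<Longrightarrow> x < 1 \<Longrightarrow> (f has_real_derivative 0) (at x)"
    and lim: "(f \<longlongrightarrow> l) (at_right 0)" and x: "0 < x" "x < 1"
  shows "f x = l"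
proof -
  have "\<exists>c. \<forall>y\<in>{0<..<1}. f y = c"
    using assms(1) by (intro has_field_derivative_zero_constant)
      (auto intro: has_field_derivative_at_within)
  then obtain c where c: "\<And>y. y \<in> {0<..<1} \<Longrightarrow> f y = c" by blast
  have "eventually (\<lambda>y. f y = c) (at_right 0)"
    using eventually_at_right_real[OF zero_less_one] by eventually_elim (use c in auto)
  then have "(f \<longlongrightarrow> c) (at_right 0)"
    by (simp add: tendsto_eventually)
  with lim have "c = l"
    using tendsto_unique[of "at_right (0::real)"] by auto
  with c x show ?thesis by auto
qed

text \<open>
  Absolute summability of the coefficients makes them a Weierstrass majorant on all of \<open>[0, 1]\<close>, so
  boundary values at \<open>1\<close> are limits without an appeal to Abel's theorem.
\<close>
lemma continuous_on_absolutely_convergent_power_series: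
  fixes c :: "nat \<Rightarrow> real"
  assumes "summable (\<lambda>k. \<bar>c k\<bar>)"
  shows "continuous_on {0..1} (\<lambda>x. \<Sum>k. c k * x ^ k)"
proof -
  have "uniform_limit {0..1} (\<lambda>n x. \<Sum>k<n. c k * x ^ k) (\<lambda>x. \<Sum>k. c k * x ^ k) sequentially"
    by (rule Weierstrass_m_test[OF _ assms])
      (auto simp: abs_mult power_abs intro!: mult_left_le power_le_one)
  then show ?thesis
    by (rule uniform_limit_theorem[rotated]) (auto intro!: always_eventually continuous_intros)
qed

lemma absolutely_convergent_power_series_limits:
  fixes c :: "nat \<Rightarrow> real"
  assumes "summable (\<lambda>k. \<bar>c k\<bar>)"
  shows "((\<lambda>x. \<Sum>k. c k * x ^ k) \<longlongrightarrow> c 0) (at_right 0)"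
    and "((\<lambda>x. \<Sum>k. c k * x ^ k) \<longlongrightarrow> (\<Sum>k. c k)) (at_left 1)"
proof -
  note C = continuous_on_absolutely_convergent_power_series[OF assms]
  show "((\<lambda>x. \<Sum>k. c k * x ^ k) \<longlongrightarrow> c 0) (at_right 0)"
    using C[unfolded continuous_on_def, rule_format, of 0]
    by (simp add: at_within_Icc_at_right)
  show "((\<lambda>x. \<Sum>k. c k * x ^ k) \<longlongrightarrow> (\<Sum>k. c k)) (at_left 1)"
    using C[unfolded continuous_on_def, rule_format, of 1]
    by (simp add: at_within_Icc_at_left)
qed

text \<open>
  Polylogarithms and the harmonic series below lose one factor \<open>1 / k\<close> under the Euler operator
  \<open>x * d/dx\<close>, which keeps the index in place; this form avoids the shift in the usual derivative series.
\<close>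
lemma has_derivative_power_series_Euler:
  fixes c :: "nat \<Rightarrow> real"
  assumes "summable (\<lambda>k. \<bar>c k\<bar>)" and x: "0 < x" "x < 1"
    and D: "(\<lambda>k. real k * c k * x ^ k) sums D"
  shows "((\<lambda>x. \<Sum>k. c k * x ^ k) has_real_derivative D / x) (at x)"
proof -
  have "summable (\<lambda>k. c k * 1 ^ k)"
    using summable_rabs_cancel[OF assms(1)] by simp
  then have "((\<lambda>x. \<Sum>k. c k * x ^ k) has_real_derivative (\<Sum>k. diffs c k * x ^ k)) (at x)"
    by (rule termdiffs_strong) (use x in auto)
  moreover have "(\<lambda>k. diffs c k * x ^ k) sums (D / x)"
  proof -
    have "(\<lambda>k. real (Suc k) * c (Suc k) * x ^ Suc k) sums D"
      using D sums_Suc_iff[of "\<lambda>k. real k * c k * x ^ k" D] by simp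
    from sums_divide[OF this, of x] show ?thesis
      using x by (simp add: diffs_def mult.assoc)
  qed
  ultimately show ?thesis by (simp add: sums_iff)
qed

section \<open>Polylogarithms and the dilogarithm reflection formula\<close>

lemma summable_inverse_power_abs:
  assumes "m \<ge> 2"
  shows "summable (\<lambda>k. \<bar>1 / real k ^ m\<bar>)"
  using inverse_power_summable[OF assms, where 'a=real] by (simp add: inverse_eq_divide)

text \<open>
  Indexing from \<open>0\<close> is harmless because \<open>1 / 0 = 0\<close>, and it makes the power series lemmas applicable.
\<close>
lemma polylog_eq_power_series:
  assumes "m \<ge> 2" and "0 \<le> x" "x \<le> 1"
  shows "(\<lambda>k. 1 / real k ^ m * x ^ k) sums polylog m x"
proof -
  have "summable (\<lambda>k. 1 / real k ^ m * x ^ k)"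
    by (rule summable_comparison_test'[OF summable_inverse_power_abs[OF assms(1)], of 0])
      (use assms in \<open>auto simp: abs_mult power_abs intro!: mult_left_le power_le_one divide_right_mono\<close>)
  moreover from this have "(\<Sum>k. 1 / real k ^ m * x ^ k) = polylog m x"
    using assms suminf_split_head[of "\<lambda>k. 1 / real k ^ m * x ^ k"] by (simp add: polylog_def)
  ultimately show ?thesis by (simp add: sums_iff)
qed

lemmas suminf_eq_polylog = polylog_eq_power_series[THEN sums_unique, symmetric]

lemma zeta_eq_polylog:
  assumes "m \<ge> 2"
  shows "zeta (real m) = polylog m 1"
  by (simp add: zeta_def polylog_def powr_minus powr_realpow inverse_eq_divide del: of_nat_Suc)

lemma sums_minus_ln:
  fixes t :: real
  assumes "0 < t" "t < 1"
  shows "(\<lambda>k. 1 / real k * t ^ k) sums (- ln (1 - t))"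
  using sums_minus[OF ln_series'[of "-t"]] assms by simp

lemma polylog_at_left_1:
  assumes "m \<ge> 2"
  shows "((\<lambda>x. polylog m (1 - x)) \<longlongrightarrow> polylog m 1) (at_right 0)"
proof -
  let ?f = "\<lambda>x. \<Sum>k. 1 / real k ^ m * x ^ k"
  have "(?f \<longlongrightarrow> ?f 1) (at_left 1)"
    using absolutely_convergent_power_series_limits(2)[OF summable_inverse_power_abs[OF assms]]
    by simp
  moreover have "filterlim (\<lambda>x::real. 1 - x) (at_left 1) (at_right 0)"
    by real_asymp
  ultimately have lim: "((\<lambda>x. ?f (1 - x)) \<longlongrightarrow> ?f 1) (at_right 0)"
    by (rule filterlim_compose)
  have "\<forall>\<^sub>F x in at_right 0. ?f (1 - x) = polylog m (1 - x)"
    using eventually_at_right_real[OF zero_less_one]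
    by eventually_elim (rule suminf_eq_polylog, use assms in auto)
  with lim have "((\<lambda>x. polylog m (1 - x)) \<longlongrightarrow> ?f 1) (at_right 0)"
    by (rule Lim_transform_eventually)
  then show ?thesis
    using suminf_eq_polylog[OF assms, of 1] by (simp only: zero_le_one order_refl)
qed

lemma polylog_at_right_0:
  assumes "m \<ge> 2"
  shows "(polylog m \<longlongrightarrow> 0) (at_right 0)"
proof -
  let ?f = "\<lambda>x. \<Sum>k. 1 / real k ^ m * x ^ k"
  have "(?f \<longlongrightarrow> 0) (at_right 0)"
    using absolutely_convergent_power_series_limits(1)[OF summable_inverse_power_abs[OF assms]]
      assms by (simp add: power_0_left)
  moreover have "\<forall>\<^sub>F x in at_right 0. ?f x = polylog m x"
    using eventually_at_right_real[OF zero_less_one]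
    by eventually_elim (rule suminf_eq_polylog, use assms in auto)
  ultimately show ?thesis
    by (rule Lim_transform_eventually)
qed

lemma has_derivative_polylog:
  assumes "m \<ge> 2" "0 < x" "x < 1"
    and D: "(\<lambda>k. 1 / real k ^ (m - 1) * x ^ k) sums D"
  shows "(polylog m has_real_derivative D / x) (at x)"
proof -
  let ?f = "\<lambda>x. \<Sum>k. 1 / real k ^ m * x ^ k"
  have "real k * (1 / real k ^ m) = 1 / real k ^ (m - 1)" for k
    using assms(1) by (cases m; cases "k = 0") auto
  then have "(?f has_real_derivative D / x) (at x)"
    by (intro has_derivative_power_series_Euler summable_inverse_power_abs) (use assms in auto)
  moreover have "?f y = polylog m y" if "y \<in> {0<..<1}" for y
    by (rule suminf_eq_polylog) (use assms that in auto)
  ultimately show ?thesis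
    using assms has_field_derivative_transform_within_open[of ?f "D / x" x "{0<..<1}" "polylog m"]
    by auto
qed

lemma has_derivative_dilog:
  assumes "0 < x" "x < 1"
  shows "(polylog 2 has_real_derivative - ln (1 - x) / x) (at x)"
  using has_derivative_polylog[of 2 x "- ln (1 - x)"] sums_minus_ln[of x] assms by simp

lemma has_derivative_trilog:
  assumes "0 < x" "x < 1"
  shows "(polylog 3 has_real_derivative polylog 2 x / x) (at x)"
  using has_derivative_polylog[of 3 x "polylog 2 x"] polylog_eq_power_series[of 2 x] assms by simp

text \<open>
  The derivative vanishes since \<open>ln t * ln (1 - t)\<close> contributes exactly the negatives of the two dilogarithm
  derivatives; the constant is read off at \<open>0\<close>, where only the value at \<open>1\<close> of the dilogarithm survives.
\<close>
lemma dilog_reflection: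
  assumes "0 < t" "t < 1"
  shows "polylog 2 t + polylog 2 (1 - t) + ln t * ln (1 - t) = zeta 2"
proof (rule constant_on_unit_interval[OF _ _ assms])
  fix x :: real assume x: "0 < x" "x < 1"
  have Li2: "((\<lambda>x. polylog 2 (1 - x)) has_real_derivative (- ln (1 - (1 - x)) / (1 - x)) * (- 1)) (at x)"
    by (rule DERIV_chain'[where g = "polylog 2" and f = "\<lambda>x. 1 - x", rotated])
      (use x has_derivative_dilog[of "1 - x"] in \<open>auto intro!: derivative_eq_intros\<close>)
  have ln: "(ln has_real_derivative 1 / x) (at x)"
    and ln': "((\<lambda>x. ln (1 - x)) has_real_derivative - 1 / (1 - x)) (at x)"
    using x by (auto intro!: derivative_eq_intros)
  show "((\<lambda>t. polylog 2 t + polylog 2 (1 - t) + ln t * ln (1 - t)) has_real_derivative 0) (at x)"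
    by (rule DERIV_cong[OF DERIV_add[OF DERIV_add[OF has_derivative_dilog[OF x] Li2] DERIV_mult[OF ln ln']]])
      (simp add: divide_inverse)
next
  have "((\<lambda>t::real. ln t * ln (1 - t)) \<longlongrightarrow> 0) (at_right 0)"
    by real_asymp
  with polylog_at_right_0[of 2] polylog_at_left_1[of 2]
  have "((\<lambda>t. polylog 2 t + polylog 2 (1 - t) + ln t * ln (1 - t)) \<longlongrightarrow> 0 + polylog 2 1 + 0) (at_right 0)"
    by (intro tendsto_add) auto
  then show "((\<lambda>t. polylog 2 t + polylog 2 (1 - t) + ln t * ln (1 - t)) \<longlongrightarrow> zeta 2) (at_right 0)"
    using zeta_eq_polylog[of 2] by simp
qed

section \<open>Harmonic series without binomial coefficients\<close>

text \<open>
  By partial fractions \<open>1 / (i * (k - i)) = (1 / i + 1 / (k - i)) / k\<close>, and the two halves agree by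
  symmetry.  The end points \<open>i = 0\<close> and \<open>i = k\<close> contribute \<open>0\<close> because \<open>1 / 0 = 0\<close>.
\<close>
lemma sum_inverse_products_eq_harm:
  "(\<Sum>i\<le>k. 1 / real i * (1 / real (k - i))) = 2 * (harm (k - 1) / real k)"
proof (cases k)
  case (Suc m)
  have "(\<Sum>i\<le>k. 1 / real i * (1 / real (k - i))) = (\<Sum>i=1..m. 1 / real i * (1 / real (k - i)))"
    by (rule sum.mono_neutral_right) (auto simp: Suc)
  also have "\<dots> = (\<Sum>i=1..m. (1 / real i + 1 / real (Suc m - i)) / real k)"
  proof (rule sum.cong)
    fix i assume "i \<in> {1..m}"
    then have "real i > 0" "real (Suc m - i) > 0" "real k = real i + real (Suc m - i)"
      by (auto simp: Suc)
    then show "1 / real i * (1 / real (k - i)) = (1 / real i + 1 / real (Suc m - i)) / real k"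
      by (simp add: Suc divide_simps del: of_nat_Suc of_nat_diff)
  qed simp
  also have "\<dots> = ((\<Sum>i=1..m. 1 / real i) + (\<Sum>i=1..m. 1 / real (Suc m - i))) / real k"
    by (simp add: sum_divide_distrib sum.distrib add_divide_distrib)
  also have "(\<Sum>i=1..m. 1 / real (Suc m - i)) = (\<Sum>i=1..m. 1 / real i)"
    by (rule sum.reindex_bij_witness[of _ "\<lambda>i. Suc m - i" "\<lambda>i. Suc m - i"]) auto
  finally show ?thesis
    by (simp add: Suc harm_def inverse_eq_divide)
qed simp

text \<open>The Cauchy square of the series of \<open>- ln (1 - t)\<close>.\<close>
lemma sums_half_ln_squared:
  assumes "0 < t" "t < 1"
  shows "(\<lambda>k. harm (k - 1) / real k * t ^ k) sums ((ln (1 - t))\<^sup>2 / 2)"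
proof -
  let ?f = "\<lambda>k. 1 / real k * t ^ k"
  have ln: "?f sums (- ln (1 - t))"
    using sums_minus_ln[OF assms] .
  then have "summable (\<lambda>k. norm (?f k))"
    using assms by (simp add: abs_mult power_abs sums_iff)
  then have "(\<lambda>k. \<Sum>i\<le>k. ?f i * ?f (k - i)) sums ((\<Sum>k. ?f k) * (\<Sum>k. ?f k))"
    by (intro Cauchy_product_sums)
  moreover have "(\<Sum>i\<le>k. ?f i * ?f (k - i)) = 2 * (harm (k - 1) / real k * t ^ k)" for k
  proof -
    have "(\<Sum>i\<le>k. ?f i * ?f (k - i)) = (\<Sum>i\<le>k. 1 / real i * (1 / real (k - i))) * t ^ k"
      unfolding sum_distrib_right by (rule sum.cong) (auto simp flip: power_add)
    then show ?thesis
      by (simp only: sum_inverse_products_eq_harm mult.assoc)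
  qed
  ultimately have "(\<lambda>k. 2 * (harm (k - 1) / real k * t ^ k)) sums (ln (1 - t))\<^sup>2"
    using ln by (simp add: sums_iff power2_eq_square)
  from sums_divide[OF this, of 2] show ?thesis by simp
qed

text \<open>
  A crude bound, but any power of \<open>n\<close> below \<open>1\<close> suffices for the convergence of \<open>H(k - 1) / k\<^sup>2\<close> summed over \<open>k\<close>.
\<close>
lemma harm_le_2_sqrt: "harm n \<le> 2 * sqrt (real n)"
proof (induction n)
  case (Suc n)
  let ?a = "sqrt (real n)" and ?b = "sqrt (real (Suc n))"
  have "?b > 0" "?a \<le> ?b" by auto
  have "1 = (?b - ?a) * (?b + ?a)"
    by (simp add: algebra_simps)
  also have "\<dots> \<le> (?b - ?a) * (2 * ?b)"
    using \<open>?a \<le> ?b\<close> by (intro mult_left_mono) auto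
  finally have "1 / ?b \<le> 2 * (?b - ?a)"
    using \<open>?b > 0\<close> by (simp add: field_simps)
  moreover have "1 / real (Suc n) \<le> 1 / ?b"
  proof -
    have "1 * ?b \<le> ?b * ?b" 
      by (intro mult_right_mono) auto
    then have "?b \<le> real (Suc n)" by simp
    then show ?thesis using \<open>?b > 0\<close> by (intro divide_left_mono) auto
  qed
  ultimately have "1 / real (Suc n) \<le> 2 * (?b - ?a)" by (rule order_trans[rotated])
  then have "1 / real (Suc n) \<le> 2 * ?b - 2 * ?a" by (simp only: right_diff_distrib)
  with Suc show ?case by (simp add: harm_Suc inverse_eq_divide del: of_nat_Suc)
qed (simp add: harm_def)

lemma summable_harm_over_square:
  "summable (\<lambda>k. \<bar>harm (k - 1) / (real k)\<^sup>2\<bar>)"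
proof (rule summable_comparison_test')
  show "summable (\<lambda>k. 2 * real k powr (- (3 / 2)))"
    by (intro summable_mult) (simp add: summable_real_powr_iff)
  fix k :: nat assume "k \<ge> 1"
  have "harm (k - 1) \<le> 2 * sqrt (real (k - 1))" by (rule harm_le_2_sqrt)
  also have "\<dots> \<le> 2 * sqrt (real k)" by simp
  finally have "harm (k - 1) / (real k)\<^sup>2 \<le> 2 * sqrt (real k) / (real k)\<^sup>2"
    by (intro divide_right_mono) auto
  also have "\<dots> = 2 * (real k powr (1 / 2) / real k powr 2)"
    using \<open>k \<ge> 1\<close> by (simp add: powr_half_sqrt)
  also have "\<dots> = 2 * real k powr (- (3 / 2))"
    using powr_diff[of "real k" "1 / 2" 2] by simp
  finally show "norm \<bar>harm (k - 1) / (real k)\<^sup>2\<bar> \<le> 2 * real k powr (- (3 / 2))"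
    by (simp add: harm_nonneg)
qed

text \<open>
  The case \<open>n = 0\<close>.  The difference of the two sides is constant: after the reflection formula
  has removed \<open>polylog 2 (1 - x)\<close>, its derivative is a linear combination of \<open>1 / x\<close> and \<open>1 / (1 - x)\<close>
  whose coefficients cancel.  At \<open>0\<close> all terms but \<open>polylog 3 1 = zeta 3\<close> vanish.
\<close>
lemma sums_harm_over_square:
  assumes t: "0 < t" "t < 1"
  shows "(\<lambda>k. harm (k - 1) / (real k)\<^sup>2 * t ^ k) sums
    (zeta 3 - polylog 3 (1 - t) + (zeta 2 - polylog 2 t) * ln (1 - t) - ln t * (ln (1 - t))\<^sup>2 / 2)"
proof -
  define c :: "nat \<Rightarrow> real" where "c k = harm (k - 1) / (real k)\<^sup>2" for k
  define f where "f x = (\<Sum>k. c k * x ^ k)" for x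
  define g where "g x = f x + polylog 3 (1 - x) - (zeta 2 - polylog 2 x) * ln (1 - x)
    + ln x * (ln (1 - x))\<^sup>2 / 2" for x
  have c: "summable (\<lambda>k. \<bar>c k\<bar>)"
    unfolding c_def by (rule summable_harm_over_square)
  have "g t = zeta 3"
  proof (rule constant_on_unit_interval[OF _ _ t])
    fix x :: real assume x: "0 < x" "x < 1"
    have "(\<lambda>k. real k * c k * x ^ k) sums ((ln (1 - x))\<^sup>2 / 2)"
    proof -
      have "real k * c k = harm (k - 1) / real k" for k
        by (simp add: c_def power2_eq_square)
      with sums_half_ln_squared[OF x] show ?thesis by simp
    qed
    then have f: "(f has_real_derivative ((ln (1 - x))\<^sup>2 / 2) / x) (at x)"
      unfolding f_def by (rule has_derivative_power_series_Euler[OF c x])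
    have Li3: "((\<lambda>x. polylog 3 (1 - x)) has_real_derivative polylog 2 (1 - x) / (1 - x) * (- 1)) (at x)"
      by (rule DERIV_chain'[where g = "polylog 3" and f = "\<lambda>x. 1 - x", rotated])
        (use x in \<open>auto intro!: has_derivative_trilog derivative_eq_intros\<close>)
    have Li2: "polylog 2 (1 - x) = zeta 2 - polylog 2 x - ln x * ln (1 - x)"
      using dilog_reflection[OF x] by simp
    have ln: "(ln has_real_derivative 1 / x) (at x)"
      and ln': "((\<lambda>x. ln (1 - x)) has_real_derivative - 1 / (1 - x)) (at x)"
      using x by (auto intro!: derivative_eq_intros)
    have ln_sq: "((\<lambda>x. (ln (1 - x))\<^sup>2) has_real_derivative 2 * ln (1 - x) * (- 1 / (1 - x))) (at x)"
      using DERIV_power[OF ln', of 2] by simp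
    have prod: "((\<lambda>x. (zeta 2 - polylog 2 x) * ln (1 - x)) has_real_derivative
        (0 - (- ln (1 - x) / x)) * ln (1 - x) + - 1 / (1 - x) * (zeta 2 - polylog 2 x)) (at x)"
      by (rule DERIV_mult[OF DERIV_diff[OF DERIV_const has_derivative_dilog[OF x]] ln'])
    have rem: "((\<lambda>x. ln x * (ln (1 - x))\<^sup>2 / 2) has_real_derivative
        (1 / x * (ln (1 - x))\<^sup>2 + 2 * ln (1 - x) * (- 1 / (1 - x)) * ln x) / 2) (at x)"
      by (rule DERIV_cdivide[OF DERIV_mult[OF ln ln_sq]])
    \<comment> \<open>The derivative of \<open>g\<close> with \<open>L = ln (1 - x)\<close>, \<open>M = ln x\<close>, \<open>P = polylog 2 x\<close>, \<open>Z = zeta 2\<close>.\<close>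
    have cancel: "L\<^sup>2 / 2 / x + (Z - P - M * L) / (1 - x) * (- 1)
        - ((0 - (- L / x)) * L + - 1 / (1 - x) * (Z - P))
        + (1 / x * L\<^sup>2 + 2 * L * (- 1 / (1 - x)) * M) / 2 = 0" for L M P Z :: real
    proof -
      define a b where "a = inverse x" and "b = inverse (1 - x)"
      show ?thesis
        unfolding divide_inverse a_def[symmetric] b_def[symmetric]
        by (simp add: power2_eq_square algebra_simps)
    qed
    show "(g has_real_derivative 0) (at x)"
      unfolding g_def
      by (rule DERIV_cong[OF DERIV_add[OF DERIV_diff[OF DERIV_add[OF f Li3] prod] rem]])
        (simp only: Li2 cancel)
  next
    have "(f \<longlongrightarrow> 0) (at_right 0)"
      using absolutely_convergent_power_series_limits(1)[OF c] by (simp add: f_def[abs_def] c_def)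
    moreover have "((\<lambda>x::real. ln (1 - x)) \<longlongrightarrow> 0) (at_right 0)"
      by real_asymp
    moreover have "((\<lambda>x::real. ln x * (ln (1 - x))\<^sup>2 / 2) \<longlongrightarrow> 0) (at_right 0)"
      by real_asymp
    ultimately have "(g \<longlongrightarrow> 0 + polylog 3 1 - (zeta 2 - 0) * 0 + 0) (at_right 0)"
      unfolding g_def
      by (intro tendsto_add tendsto_diff tendsto_mult tendsto_const polylog_at_left_1 polylog_at_right_0) auto
    then show "(g \<longlongrightarrow> zeta 3) (at_right 0)"
      using zeta_eq_polylog[of 3] by simp
  qed
  moreover have "(\<lambda>k. c k * t ^ k) sums f t"
  proof -
    have "summable (\<lambda>k. c k * t ^ k)"
      by (rule summable_comparison_test'[OF c, of 0])
        (use t in \<open>auto simp: abs_mult power_abs intro!: mult_left_le power_le_one\<close>)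
    then show ?thesis by (simp add: f_def summable_sums)
  qed
  moreover have "f t = zeta 3 - polylog 3 (1 - t) + (zeta 2 - polylog 2 t) * ln (1 - t)
      - ln t * (ln (1 - t))\<^sup>2 / 2"
    using \<open>g t = zeta 3\<close> unfolding g_def by linarith
  ultimately show ?thesis
    by (simp only: c_def)
qed

section \<open>Inverse binomial coefficients as Beta values\<close>

text \<open>
  For \<open>k > 0\<close> this is \<open>B(k, n + 1)\<close>, the integral of \<open>x ^ (k - 1) * (1 - x) ^ n\<close> over \<open>[0, 1]\<close>.  The factor
  \<open>1 / k\<close> belongs to the weight because only then do the Pascal rule and \<open>beta_weight 0 k = 1 / k\<close> hold.
\<close>
definition beta_weight :: "nat \<Rightarrow> nat \<Rightarrow> real" where
  "beta_weight n k = 1 / (real k * real ((n + k) choose k))"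

lemma beta_weight_0_right [simp]: "beta_weight n 0 = 0"
  and beta_weight_0_left [simp]: "beta_weight 0 k = 1 / real k"
  by (simp_all add: beta_weight_def)

lemma beta_weight_Suc: "beta_weight n (Suc k) = fact n * fact k / fact (Suc (n + k))"
proof -
  have "real ((n + Suc k) choose Suc k) = fact (n + Suc k) / (fact (Suc k) * fact n)"
    using binomial_fact[of "Suc k" "n + Suc k", where 'a = real] by simp
  then show ?thesis
    by (simp only: beta_weight_def) (simp add: divide_simps del: of_nat_Suc)
qed

text \<open>
  Under the integral this is \<open>(1 - x) ^ Suc n = (1 - x) ^ n - x * (1 - x) ^ n\<close>.
\<close>
lemma beta_weight_Pascal:
  "beta_weight (Suc n) (Suc k) = beta_weight n (Suc k) - beta_weight n (Suc (Suc k))"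
proof -
  have "fact (Suc (Suc (n + k))) = real (n + k + 2) * fact (Suc (n + k))" by simp
  then show ?thesis
    by (simp add: beta_weight_Suc divide_simps del: fact_Suc) (simp add: algebra_simps)
qed

text \<open>
  This is integration by parts.  It is what turns the correction \<open>1 / k\<close>, arising from \<open>H(k) - H(k - 1)\<close>
  in the Pascal rule with harmonic factors, into the \<open>k\<close>-independent factor \<open>1 / (n + 1)\<close>.
\<close>
lemma beta_weight_exchange:
  "beta_weight n (Suc (Suc k)) / real (Suc k) = beta_weight (Suc n) (Suc k) / real (Suc n)"
  by (simp add: beta_weight_Suc divide_simps)

text \<open>
  The coefficientwise form of the recurrence for \<open>T\<close>: the Pascal rule, with \<open>harm k\<close> in the shifted term
  so that this term is the next coefficient of the same series.
\<close>
lemma harm_beta_weight_Suc: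
  "harm (k - 1) * beta_weight (Suc n) k
    = harm (k - 1) * beta_weight n k - harm k * beta_weight n (Suc k) + beta_weight (Suc n) k / real (Suc n)"
proof (cases k)
  case (Suc j)
  have "harm k = harm (k - 1) + 1 / real k"
    by (simp add: Suc harm_Suc inverse_eq_divide)
  with beta_weight_exchange[of n j] show ?thesis
    by (simp add: Suc beta_weight_Pascal algebra_simps del: of_nat_Suc)
qed (simp add: harm_def)

text \<open>
  This comes from \<open>beta_weight (Suc n) k * (n + 1 + k) = beta_weight n k * (n + 1)\<close> after division
  by \<open>k * (n + 1)\<close>: with the extra division by \<open>k\<close>, the step in \<open>n\<close> involves no
  shift of \<open>k\<close>, so that the series of the theorem changes by a multiple of \<open>T (n + 1)\<close> only.
\<close>
lemma beta_weight_over_Suc: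
  "beta_weight (Suc n) k / real k = beta_weight n k / real k - beta_weight (Suc n) k / real (Suc n)"
proof (cases k)
  case (Suc j)
  have "fact (Suc (Suc (n + j))) = real (n + j + 2) * fact (Suc (n + j))" by simp
  then show ?thesis
    by (simp add: Suc beta_weight_Suc divide_simps del: fact_Suc) (simp add: algebra_simps)
qed simp

section \<open>The finite sums and their recurrences\<close>

text \<open>
  These are the solutions of the recurrences for \<open>V n\<close> and \<open>T n\<close> with initial values \<open>- ln (1 - t)\<close> and
  \<open>(ln (1 - t))\<^sup>2 / 2\<close>.  Both are polynomials in \<open>u = (t - 1) / t\<close> with logarithms only in the coefficient
  of the top power \<open>u ^ n\<close>.
\<close>
definition beta_sum :: "nat \<Rightarrow> real \<Rightarrow> real" where
  "beta_sum n t = - ln (1 - t) * ((t - 1) / t) ^ n + (\<Sum>p<n. ((t - 1) / t) ^ p / real (n - p))"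

definition harm_beta_sum :: "nat \<Rightarrow> real \<Rightarrow> real" where
  "harm_beta_sum n t = ((ln (1 - t))\<^sup>2 / 2 - harm n * ln (1 - t)) * ((t - 1) / t) ^ n
    + (\<Sum>p<n. ((harm n - harm (n - p)) / real (n - p) + 1 / (real (n - p))\<^sup>2) * ((t - 1) / t) ^ p)"

lemma beta_sum_Suc:
  "beta_sum (Suc n) t = (t - 1) / t * beta_sum n t + 1 / real (Suc n)"
proof -
  define u where "u = (t - 1) / t"
  show ?thesis
    unfolding beta_sum_def u_def[symmetric]
    by (subst sum.lessThan_Suc_shift) (simp add: sum_distrib_left algebra_simps)
qed

text \<open>
  Passing from \<open>harm n\<close> to \<open>harm (Suc n)\<close> in the coefficients adds \<open>1 / (n + 1)\<close> times the coefficients of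
  \<open>beta_sum (Suc n)\<close>; what is left is a shift of the powers of \<open>u\<close>, whose new constant term is \<open>0\<close>.
\<close>
lemma harm_beta_sum_Suc:
  "harm_beta_sum (Suc n) t = (t - 1) / t * harm_beta_sum n t + beta_sum (Suc n) t / real (Suc n)"
proof -
  define u where "u = (t - 1) / t"
  have coeff: "(harm (Suc n) - harm m) / real m + 1 / (real m)\<^sup>2
      = ((harm n - harm m) / real m + 1 / (real m)\<^sup>2) + 1 / real m / real (Suc n)" for m
    by (simp add: harm_Suc inverse_eq_divide add_divide_distrib diff_divide_distrib del: of_nat_Suc)
  have "(\<Sum>p<Suc n. ((harm (Suc n) - harm (Suc n - p)) / real (Suc n - p) + 1 / (real (Suc n - p))\<^sup>2) * u ^ p)
      = (\<Sum>p<Suc n. ((harm n - harm (Suc n - p)) / real (Suc n - p) + 1 / (real (Suc n - p))\<^sup>2) * u ^ p)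
        + (\<Sum>p<Suc n. u ^ p / real (Suc n - p)) / real (Suc n)"
    by (simp only: coeff distrib_right sum.distrib sum_divide_distrib)
      (simp only: times_divide_eq_left times_divide_eq_right divide_divide_eq_left
        mult_1_left mult_1_right mult.commute)
  also have "(\<Sum>p<Suc n. ((harm n - harm (Suc n - p)) / real (Suc n - p) + 1 / (real (Suc n - p))\<^sup>2) * u ^ p)
      = ((harm n - harm (Suc n)) / real (Suc n) + 1 / (real (Suc n))\<^sup>2)
        + u * (\<Sum>p<n. ((harm n - harm (n - p)) / real (n - p) + 1 / (real (n - p))\<^sup>2) * u ^ p)"
    by (subst sum.lessThan_Suc_shift) (simp add: sum_distrib_left mult_ac del: of_nat_Suc)
  also have "(harm n - harm (Suc n)) / real (Suc n) + 1 / (real (Suc n))\<^sup>2 = 0"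
    by (simp add: harm_Suc power2_eq_square inverse_eq_divide del: of_nat_Suc)
  finally show ?thesis
    unfolding harm_beta_sum_def beta_sum_def u_def[symmetric]
    by (simp only: harm_Suc[of n])
      (simp add: inverse_eq_divide distrib_left distrib_right left_diff_distrib right_diff_distrib
        add_divide_distrib diff_divide_distrib mult_ac del: of_nat_Suc of_nat_diff sum.lessThan_Suc)
qed

text \<open>
  Raising \<open>n\<close> extends the inner sum for each \<open>p\<close> by its term at \<open>k = n + 1 - p\<close>.  On this diagonal
  \<open>p + k = n + 1\<close>, so a common factor \<open>1 / (n + 1)\<close> comes out and the coefficients of \<open>harm_beta_sum (Suc n)\<close> remain.
\<close>
lemma closed_form_Suc:
  "closed_form (Suc n) t = closed_form n t - harm_beta_sum (Suc n) t / real (Suc n)"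
proof -
  define u where "u = (t - 1) / t"
  define c where "c p k = (harm (p + k) - harm k) / (real (p + k) * real k)
    + 1 / ((real k)\<^sup>2 * real (p + k))" for p k
  have diag: "c p (Suc n - p) = ((harm (Suc n) - harm (Suc n - p)) / real (Suc n - p)
      + 1 / (real (Suc n - p))\<^sup>2) / real (Suc n)" if "p < Suc n" for p
  proof -
    have "p + (Suc n - p) = Suc n" using that by simp
    then show ?thesis
      by (simp only: c_def) (simp add: add_divide_distrib del: of_nat_Suc of_nat_diff)
  qed
  have split: "(\<Sum>k=1..Suc n - p. c p k) = (\<Sum>k=1..n - p. c p k) + c p (Suc n - p)" if "p < Suc n" for p
    using that by (simp add: Suc_diff_le)
  have "(\<Sum>p<Suc n. (\<Sum>k=1..Suc n - p. c p k) * u ^ p)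
      = (\<Sum>p<Suc n. (\<Sum>k=1..n - p. c p k) * u ^ p) + (\<Sum>p<Suc n. c p (Suc n - p) * u ^ p)"
    unfolding sum.distrib[symmetric]
    by (rule sum.cong[OF refl]) (simp only: lessThan_iff split distrib_right)
  also have "(\<Sum>p<Suc n. (\<Sum>k=1..n - p. c p k) * u ^ p) = (\<Sum>p<n. (\<Sum>k=1..n - p. c p k) * u ^ p)"
    by simp
  also have "(\<Sum>p<Suc n. c p (Suc n - p) * u ^ p) = (\<Sum>p<Suc n. ((harm (Suc n) - harm (Suc n - p)) / real (Suc n - p)
      + 1 / (real (Suc n - p))\<^sup>2) * u ^ p) / real (Suc n)"
    unfolding sum_divide_distrib
    by (rule sum.cong[OF refl]) (simp only: lessThan_iff diag times_divide_eq_left)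
  finally show ?thesis
    unfolding closed_form_def harm_beta_sum_def u_def[symmetric] c_def[symmetric] atLeast0LessThan
    by (simp add: algebra_simps add_divide_distrib diff_divide_distrib del: of_nat_Suc sum.lessThan_Suc)
qed

section \<open>Summation for arguments inside the unit interval\<close>

lemma sums_shift_divide:
  fixes f :: "nat \<Rightarrow> real"
  assumes "f 0 = 0" "f sums s"
  shows "(\<lambda>k. f (Suc k) / t) sums (s / t)"
  using assms sums_Suc_iff[of f s] by (intro sums_divide) simp

lemma sums_beta_weight:
  assumes t: "0 < t" "t < 1"
  shows "(\<lambda>k. beta_weight n k * t ^ k) sums beta_sum n t"
proof (induction n)
  case 0
  show ?case using sums_minus_ln[OF t] by (simp add: beta_sum_def)
next
  case (Suc n)
  let ?f = "\<lambda>n k. beta_weight n k * t ^ k"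
  have "(\<lambda>k. ?f n k - ?f n (Suc k) / t + (if k = 0 then 1 / real (Suc n) else 0))
      sums (beta_sum n t - beta_sum n t / t + 1 / real (Suc n))"
    \<comment> \<open>At \<open>k = 0\<close> the Pascal difference is \<open>- 1 / (n + 1)\<close> instead of \<open>0\<close>; the indicator term repairs this.\<close>
    using sums_If_finite[of "\<lambda>k. k = 0" "\<lambda>_. 1 / real (Suc n)"]
    by (intro sums_add sums_diff Suc sums_shift_divide) auto
  moreover have "?f n k - ?f n (Suc k) / t + (if k = 0 then 1 / real (Suc n) else 0) = ?f (Suc n) k" for k
  proof (cases k)
    case 0
    have "beta_weight n (Suc 0) = 1 / real (Suc n)"
      by (simp add: beta_weight_def)
    with 0 t show ?thesis by simp
  next
    case (Suc j)
    with t show ?thesis by (simp add: beta_weight_Pascal algebra_simps)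
  qed
  moreover have "beta_sum n t - beta_sum n t / t + 1 / real (Suc n) = beta_sum (Suc n) t"
    using t by (simp add: beta_sum_Suc diff_divide_distrib left_diff_distrib)
  ultimately show ?case by simp
qed

lemma sums_harm_beta_weight:
  assumes t: "0 < t" "t < 1"
  shows "(\<lambda>k. harm (k - 1) * beta_weight n k * t ^ k) sums harm_beta_sum n t"
proof (induction n)
  case 0
  show ?case using sums_half_ln_squared[OF t] by (simp add: harm_beta_sum_def harm_def)
next
  case (Suc n)
  let ?g = "\<lambda>n k. harm (k - 1) * beta_weight n k * t ^ k"
  have "(\<lambda>k. ?g n k - ?g n (Suc k) / t + beta_weight (Suc n) k * t ^ k / real (Suc n))
      sums (harm_beta_sum n t - harm_beta_sum n t / t + beta_sum (Suc n) t / real (Suc n))"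
    by (intro sums_add sums_diff Suc sums_shift_divide sums_divide sums_beta_weight t) simp
  moreover have "?g n k - ?g n (Suc k) / t + beta_weight (Suc n) k * t ^ k / real (Suc n) = ?g (Suc n) k" for k
    unfolding harm_beta_weight_Suc using t by (simp add: algebra_simps del: of_nat_Suc)
  moreover have "harm_beta_sum n t - harm_beta_sum n t / t + beta_sum (Suc n) t / real (Suc n)
      = harm_beta_sum (Suc n) t"
    using t by (simp add: harm_beta_sum_Suc diff_divide_distrib left_diff_distrib)
  ultimately show ?case by simp
qed

lemma sums_closed_form:
  assumes t: "0 < t" "t < 1"
  shows "(\<lambda>k. harm (k - 1) * (beta_weight n k / real k) * t ^ k) sums closed_form n t"
proof (induction n)
  case 0
  show ?case
    using sums_harm_over_square[OF t] by (simp add: closed_form_def power2_eq_square)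
next
  case (Suc n)
  from sums_diff[OF Suc sums_divide[OF sums_harm_beta_weight[OF t, of "Suc n"], of "real (Suc n)"]]
  show ?case
    by (simp add: beta_weight_over_Suc closed_form_Suc algebra_simps del: of_nat_Suc)
qed

section \<open>The boundary point and the theorem\<close>

lemma summable_harm_beta_weight:
  "summable (\<lambda>k. \<bar>harm (k - 1) * (beta_weight n k / real k)\<bar>)"
proof (rule summable_comparison_test'[OF summable_harm_over_square])
  fix k :: nat assume "k \<ge> 0"
  have "beta_weight n k / real k \<le> 1 / (real k)\<^sup>2"
  proof (cases "k = 0")
    case False
    have "real ((n + k) choose k) \<ge> 1"
      using binomial_eq_0_iff[of "n + k" k] by (simp add: Suc_le_eq)
    with False show ?thesis
      by (simp add: beta_weight_def power2_eq_square divide_simps)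
  qed simp
  moreover have "beta_weight n k \<ge> 0" by (simp add: beta_weight_def)
  ultimately show "norm \<bar>harm (k - 1) * (beta_weight n k / real k)\<bar> \<le> \<bar>harm (k - 1) / (real k)\<^sup>2\<bar>"
    using mult_left_mono[of "beta_weight n k / real k" "1 / (real k)\<^sup>2" "harm (k - 1)"]
    by (simp add: abs_mult harm_nonneg)
qed

theorem theorem2p11:
  fixes n :: nat and t :: real
  assumes "n \<ge> 1" and "0 < t" and "t \<le> 1"
  shows "\<exists>S. (\<lambda>j. let k = Suc j in
                 harm (k - 1) * t ^ k / ((real k)\<^sup>2 * real ((n + k) choose k))) sums S
           \<and> (t < 1 \<longrightarrow> S = closed_form n t)
           \<and> (t = 1 \<longrightarrow> (closed_form n \<longlongrightarrow> S) (at_left 1))"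
proof -
  define c :: "nat \<Rightarrow> real" where "c k = harm (k - 1) * (beta_weight n k / real k)" for k
  have c: "summable (\<lambda>k. \<bar>c k\<bar>)"
    unfolding c_def by (rule summable_harm_beta_weight)
  have shift: "(\<lambda>j. let k = Suc j in
      harm (k - 1) * t ^ k / ((real k)\<^sup>2 * real ((n + k) choose k))) sums S"
    if "(\<lambda>k. c k * t ^ k) sums S" for S
  proof -
    have "(\<lambda>j. c (Suc j) * t ^ Suc j) sums S"
      using that sums_Suc_iff[of "\<lambda>k. c k * t ^ k" S] by (simp add: c_def)
    then show ?thesis
      by (simp add: Let_def c_def beta_weight_def power2_eq_square mult_ac del: of_nat_Suc)
  qed
  show ?thesis
  proof (cases "t < 1")
    case True
    with assms shift[of "closed_form n t"] sums_closed_form[of t n] show ?thesis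
      by (auto simp: c_def)
  next
    case False
    with assms have "t = 1" by simp
    have "\<forall>\<^sub>F x in at_left 1. (\<Sum>k. c k * x ^ k) = closed_form n x"
      using eventually_at_left_real[OF zero_less_one]
      by eventually_elim (use sums_closed_form in \<open>auto simp: c_def sums_iff\<close>)
    with absolutely_convergent_power_series_limits(2)[OF c]
    have "(closed_form n \<longlongrightarrow> (\<Sum>k. c k)) (at_left 1)"
      by (rule Lim_transform_eventually)
    moreover have "(\<lambda>k. c k * t ^ k) sums (\<Sum>k. c k)"
      using summable_rabs_cancel[OF c] \<open>t = 1\<close> by (simp add: summable_sums)
    ultimately show ?thesis
      using shift \<open>t = 1\<close> by blast
  qed
qed

end
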